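(* Let $p$ be a prime, $e$ a positive integer, $q=p^e$, and let $m,n$ be integers with $1\le m,n\le q-1$. Let $D=D(q;m,n)$ and let $d=\gcd(q-1,m,n)$. For each positive divisor $e_i$ of $e$, let $q_i=(q-1)/(p^{e_i}-1)$, and let $q_s$ be the largest of the $q_i$ that divides $d$ (with $e_s$ the corresponding divisor of $e$, so $q_s=(q-1)/(p^{e_s}-1)$). Then the following hold. (i) The vertex set of the strong component of $D$ containing a vertex $(u,v)$ is $$\{(x,v+\mathbb F_{p^{e_s}})\colon x\in\mathbb F_q\}\cup\{(x,-v+\mathbb F_{p^{e_s}})\colon x\in\mathbb F_q\}.$$ In particular, $D$ is strong if and only if $q_s=1$ or, equivalently, $e_s=e$. (ii) If $q$ is odd, then $D$ has $(p^{e-e_s}+1)/2$ strong components. One of them is of order $p^{e+e_s}$. All other $(p^{e-e_s}-1)/2$ strong components are isomorphic (to one another), and each is of order $2p^{e+e_s}$. If $q$ is even, then $D$ has $2^{e-e_s}$ strong components, all isomorphic, and each is of order $2^{e+e_s}$.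
   Context: A digraph is a pair $(V,A)$ with $A\subseteq V\times V$ (loops are allowed). Its order is $|V|$. A vertex $y$ is reachable from $x$ if there is a directed walk from $x$ to $y$; each vertex is reachable from itself. A digraph is strong (strongly connected) if for every pair of distinct vertices $x,y$, $y$ is reachable from $x$ and $x$ is reachable from $y$. A strong component is a maximal induced subdigraph that is strong. $\mathbb F_q$ is the finite field with $q$ elements, and for a positive divisor $e_i$ of $e$, $\mathbb F_{p^{e_i}}$ denotes the subfield of $\mathbb F_q$ with $p^{e_i}$ elements. For integers $1\le m,n\le q-1$, the monomial digraph $D(q;m,n)$ has vertex set $\mathbb F_q^2$, and there is an arc from $(x_1,x_2)$ to $(y_1,y_2)$ if and only if $x_2+y_2=x_1^m y_1^n$. For $x\in \mathbb F_q$ and $X\subseteq\mathbb F_q$, $(x,X)$ stands for all vertices $(x,y)$ with $y\in X$; so $\{(x,v+\mathbb F_{p^{e_s}})\colon x\in\mathbb F_q\}=\{(x,v+w)\colon x\in\mathbb F_q,\ w\in\mathbb F_{p^{e_s}}\}$. *)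

theory Defs
  imports "Graph_Theory.Graph_Theory" "HOL-Computational_Algebra.Primes" "HOL-Library.Cardinality"
begin

definition is_subfield :: "'a::field set \<Rightarrow> bool" where
  "is_subfield K \<longleftrightarrow> 0 \<in> K \<and> 1 \<in> K \<and>
     (\<forall>x\<in>K. \<forall>y\<in>K. x + y \<in> K \<and> x * y \<in> K) \<and>
     (\<forall>x\<in>K. - x \<in> K \<and> inverse x \<in> K)"

text \<open>
  A finite field has exactly one subfield of cardinality \<open>k\<close> whenever \<open>k = p ^ i\<close>, where the
  field has \<open>p ^ e\<close> elements and \<open>i\<close> divides \<open>e\<close>; the value is unspecified for other \<open>k\<close>.
\<close>
definition subfield_of_card :: "nat \<Rightarrow> 'a::{field,finite} set" where
  "subfield_of_card k = (THE K. is_subfield K \<and> card K = k)"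

text \<open>
  There are no parallel arcs, so an arc is the pair of its ends. The number \<open>q\<close> is the cardinality
  of the type \<open>'a\<close>.
\<close>
definition monomial_digraph ::
  "nat \<Rightarrow> nat \<Rightarrow> ('a::{field,finite} \<times> 'a, ('a \<times> 'a) \<times> ('a \<times> 'a)) pre_digraph" where
  "monomial_digraph m n =
     \<lparr> verts = UNIV,
       arcs = {((x1, x2), (y1, y2)) | x1 x2 y1 y2. x2 + y2 = x1 ^ m * y1 ^ n},
       tail = fst, head = snd \<rparr>"

end

theory Submission
  imports Defs "HOL-Computational_Algebra.Polynomial"
begin

text \<open>
  Write \<open>G\<close> for the set of all sums of monomial values \<open>x\<^sup>m y\<^sup>n\<close>. Products of such values are again
  such values, so \<open>G\<close> is a subsemiring of a finite field and hence a subfield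
  (\<open>is_subfield_monomial_span\<close>).

  An arc from \<open>(x, a)\<close> to \<open>(y, b)\<close> says that \<open>b\<close> is \<open>-a\<close> plus one monomial value. Walking along arcs
  therefore keeps the second coordinate inside \<open>(v + G) \<union> (-v + G)\<close>. Conversely, passing through
  vertices with first coordinate \<open>0\<close>, where the monomial vanishes, changes the sign of the second
  coordinate and the first coordinate at will, and any other arc, followed by a change of sign if
  need be, adds or subtracts one monomial value; so all of \<open>(v + G) \<union> (-v + G)\<close>, with any first coordinate, is reached
  (\<open>reachable_monomial_digraph_iff\<close>). The strong components are thus the products of the whole field
  with the signed cosets \<open>\<plusminus>v + G\<close>.

  It remains to find the order of \<open>G\<close> (\<open>card_monomial_span\<close>). By Lagrange's theorem it is \<open>p\<^sup>i\<close> for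
  some \<open>i\<close>. For every nonzero \<open>x\<close> the power \<open>x\<^sup>m\<close>
  lies in \<open>G\<close>, so that \<open>x ^ (m (p\<^sup>i - 1)) = 1\<close>; since no nonzero polynomial of degree
  less than \<open>q - 1\<close> has \<open>q - 1\<close> roots, \<open>q - 1\<close> divides \<open>m (p\<^sup>i - 1)\<close>, and likewise for \<open>n\<close>. So
  \<open>(q - 1) / (p\<^sup>i - 1)\<close> divides \<open>gcd (q - 1) (gcd m n)\<close>. On the other hand, if \<open>j\<close> divides \<open>e\<close>
  and \<open>(q - 1) / (p\<^sup>j - 1)\<close> divides that number, then the Frobenius power \<open>x \<mapsto> x ^ (p ^ j)\<close> is additive and fixes
  every monomial value, hence all of \<open>G\<close>, and it has at most \<open>p ^ j\<close> fixed points. So \<open>i\<close> is the least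
  admissible exponent, which is the one of the largest quotient. A subfield is the
  fixed-point set of its Frobenius power, so the order determines it.

  In odd characteristic \<open>v + G\<close> and \<open>-v + G\<close> are disjoint unless \<open>v \<in> G\<close>; in characteristic two they
  coincide. The orders of the components follow, and as the components partition the
  plane, so does their number. Replacing \<open>\<plusminus>v + g\<close> by \<open>\<plusminus>v' + g\<close> leaves alone
  every sum of two second coordinates that lies in \<open>G\<close>, and only such sums can come from arcs;
  it is therefore an isomorphism of components (\<open>digraph_iso_pm_cosets\<close> for odd characteristic and
  \<open>digraph_iso_pm_cosets_char_2\<close> for characteristic two).
\<close>

section \<open>Subfields of a finite field\<close>

text \<open>
  Translation by an element, and multiplication by a nonzero element, are injective and map the
  finite set \<open>K\<close> into itself. They are thus onto, and hit \<open>0\<close> and \<open>1\<close> respectively.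
\<close>

lemma is_subfield_finite_semiring:
  fixes K :: "'a::{field,finite} set"
  assumes zero: "0 \<in> K" and one: "1 \<in> K"
    and add: "\<And>x y. x \<in> K \<Longrightarrow> y \<in> K \<Longrightarrow> x + y \<in> K"
    and mult: "\<And>x y. x \<in> K \<Longrightarrow> y \<in> K \<Longrightarrow> x * y \<in> K"
  shows "is_subfield K"
proof -
  have "- x \<in> K" if x: "x \<in> K" for x
  proof -
    have "(+) x ` K = K"
      by (rule endo_inj_surj) (use add x in \<open>auto simp: inj_on_def\<close>)
    then obtain y where "y \<in> K" "0 = x + y" using zero by blast
    then show ?thesis by (metis minus_unique)
  qed
  moreover have "inverse x \<in> K" if x: "x \<in> K" for x
  proof (cases "x = 0")
    case False
    have "(*) x ` K = K"
      by (rule endo_inj_surj) (use mult x False in \<open>auto simp: inj_on_def\<close>)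
    then obtain y where "y \<in> K" "1 = x * y" using one by blast
    then show ?thesis by (metis inverse_unique)
  qed (use zero in simp)
  ultimately show ?thesis
    unfolding is_subfield_def by (simp add: assms)
qed

lemma subfield_diff:
  assumes "is_subfield K" "x \<in> K" "y \<in> K"
  shows "x - y \<in> K"
  using assms by (metis is_subfield_def diff_conv_add_uminus)

text \<open>
  Fermat's argument: multiplication by \<open>x\<close> permutes the nonzero elements of \<open>K\<close>, so it does not
  change their product.
\<close>

lemma subfield_power_card_minus_1:
  fixes K :: "'a::{field,finite} set"
  assumes K: "is_subfield K" and x: "x \<in> K" "x \<noteq> 0"
  shows "x ^ (card K - 1) = 1"
proof -
  have "(\<Prod>y\<in>K - {0}. x * y) = (\<Prod>y\<in>K - {0}. y)"
    by (rule prod.reindex_bij_witness[of _ "\<lambda>y. inverse x * y" "\<lambda>y. x * y"])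
      (use K x in \<open>auto simp: is_subfield_def mult.assoc[symmetric]\<close>)
  then have "x ^ card (K - {0}) * \<Prod>(K - {0}) = \<Prod>(K - {0})"
    by (simp add: prod.distrib)
  moreover have "\<Prod>(K - {0}) \<noteq> 0" by simp
  moreover have "0 \<in> K" using K by (simp add: is_subfield_def)
  ultimately show ?thesis by (simp add: card_Diff_singleton)
qed

lemma subfield_card_ge_2:
  fixes K :: "'a::{field,finite} set"
  assumes "is_subfield K"
  shows "2 \<le> card K"
proof -
  have "card {0, 1::'a} \<le> card K"
    by (rule card_mono) (use assms in \<open>auto simp: is_subfield_def\<close>)
  then show ?thesis by simp
qed

lemma card_roots_of_unity_le:
  fixes N :: nat
  assumes "0 < N"
  shows "card {x::'a::idom. x ^ N = 1} \<le> N"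
proof -
  let ?P = "monom (1::'a) N - 1"
  have c: "coeff ?P N = 1" using assms by simp
  then have nz: "?P \<noteq> 0" by (metis coeff_0 one_neq_zero)
  have deg: "degree ?P \<le> N"
    by (rule degree_diff_le) (auto simp: degree_monom_le)
  have "card {x. poly ?P x = 0} \<le> degree ?P"
    by (rule card_poly_roots_bound[OF nz])
  with deg show ?thesis by (simp add: poly_monom)
qed

lemma card_power_fixed_points_le:
  fixes k :: nat
  assumes "2 \<le> k"
  shows "card {x::'a::{field,finite}. x ^ k = x} \<le> k"
proof -
  have "{x::'a. x ^ k = x} \<subseteq> insert 0 {x. x ^ (k - 1) = 1}"
  proof
    fix x :: 'a assume x: "x \<in> {x. x ^ k = x}"
    have "x * x ^ (k - 1) = x ^ Suc (k - 1)" by (rule power_Suc[symmetric])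
    also have "\<dots> = x * 1" using x assms by simp
    finally show "x \<in> insert 0 {x. x ^ (k - 1) = 1}" by (cases "x = 0") simp_all
  qed
  then have "card {x::'a. x ^ k = x} \<le> card (insert 0 {x::'a. x ^ (k - 1) = 1})"
    by (intro card_mono) auto
  also have "\<dots> \<le> Suc (card {x::'a. x ^ (k - 1) = 1})"
    by (simp add: card_insert_le_m1 card_insert_if)
  also have "\<dots> \<le> k"
    using card_roots_of_unity_le[of "k - 1", where 'a = 'a] assms by linarith
  finally show ?thesis .
qed

text \<open>
  This takes the place of a primitive element. The remainder of \<open>N\<close> modulo \<open>card K - 1\<close> is again an
  exponent for the multiplicative group, and if it were positive, a polynomial of smaller degree
  than \<open>card K - 1\<close> would have all nonzero elements of \<open>K\<close> as roots.
\<close>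

lemma subfield_exponent_dvd:
  fixes K :: "'a::{field,finite} set"
  assumes K: "is_subfield K" and N: "\<And>x. x \<in> K \<Longrightarrow> x \<noteq> 0 \<Longrightarrow> x ^ N = 1"
  shows "card K - 1 dvd N"
proof (rule ccontr)
  let ?k = "card K - 1" and ?r = "N mod (card K - 1)"
  have k: "0 < ?k" using subfield_card_ge_2[OF K] by simp
  assume "\<not> ?k dvd N"
  then have r: "0 < ?r" by (simp add: mod_greater_zero_iff_not_dvd)
  have "K - {0} \<subseteq> {x. x ^ ?r = 1}"
  proof
    fix x assume x: "x \<in> K - {0}"
    have "1 = x ^ (?k * (N div ?k) + ?r)" using N x by simp
    also have "\<dots> = (x ^ ?k) ^ (N div ?k) * x ^ ?r" by (simp only: power_add power_mult)
    also have "x ^ ?k = 1" using x by (intro subfield_power_card_minus_1[OF K]) auto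
    finally show "x \<in> {x. x ^ ?r = 1}" by simp
  qed
  then have "card (K - {0}) \<le> card {x::'a. x ^ ?r = 1}" by (intro card_mono) auto
  also have "\<dots> \<le> ?r" by (rule card_roots_of_unity_le[OF r])
  also have "\<dots> < ?k" using k by simp
  finally show False using K by (simp add: card_Diff_singleton is_subfield_def)
qed

text \<open>
  Fermat's theorem gives one inclusion, and the number of roots of \<open>X\<^sup>k - X\<close> forces equality. The right
  side depends on \<open>k\<close> only, so there is at most one subfield of each order.
\<close>

lemma subfield_eq_power_fixed_points:
  fixes K :: "'a::{field,finite} set"
  assumes K: "is_subfield K" and k: "card K = k"
  shows "K = {x. x ^ k = x}"
proof (rule card_subset_eq)
  have k2: "2 \<le> k" using subfield_card_ge_2[OF K] k by simp
  show sub: "K \<subseteq> {x. x ^ k = x}"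
  proof clarify
    fix x assume "x \<in> K"
    then show "x ^ k = x"
      using subfield_power_card_minus_1[OF K, of x] k k2
      by (cases "x = 0") (auto simp: power_eq_if)
  qed
  show "card K = card {x::'a. x ^ k = x}"
    using card_mono[OF finite sub] card_power_fixed_points_le[OF k2, where 'a = 'a] k
    by simp
qed simp

lemma subfield_of_card_eqI:
  fixes K :: "'a::{field,finite} set"
  assumes "is_subfield K" "card K = k"
  shows "subfield_of_card k = K"
  unfolding subfield_of_card_def
proof (rule the_equality)
  show "K' = K" if "is_subfield K' \<and> card K' = k" for K' :: "'a set"
    using that subfield_eq_power_fixed_points[OF assms]
      subfield_eq_power_fixed_points[of K' k] by simp
qed (use assms in simp)

lemma mem_translate_iff:
  fixes v :: "'a::ab_group_add"
  shows "b \<in> (+) v ` S \<longleftrightarrow> b - v \<in> S"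
  by (auto intro: image_eqI[of _ _ "b - v"])

text \<open>
  Lagrange's theorem for the additive group: the translates of \<open>S\<close> partition the type.
\<close>

lemma additive_subgroup_card_dvd:
  fixes S :: "'a::{ab_group_add,finite} set"
  assumes "0 \<in> S" "\<And>x y. x \<in> S \<Longrightarrow> y \<in> S \<Longrightarrow> x - y \<in> S"
  shows "card S dvd CARD('a)"
proof -
  let ?C = "range (\<lambda>v. (+) v ` S)"
  have sub: "(+) v ` S \<subseteq> (+) w ` S" if c: "c \<in> (+) v ` S" "c \<in> (+) w ` S" for v w c
  proof
    fix b assume "b \<in> (+) v ` S"
    then have "b - v - (c - v) - (0 - (c - w)) \<in> S"
      using c unfolding mem_translate_iff by (meson assms)
    then show "b \<in> (+) w ` S" unfolding mem_translate_iff by simp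
  qed
  have "card S * card ?C = card (\<Union>?C)"
  proof (rule card_partition)
    show "card c = card S" if "c \<in> ?C" for c
      using that by (auto simp: card_image)
    show "A \<inter> B = {}" if "A \<in> ?C" "B \<in> ?C" "A \<noteq> B" for A B
      using that sub by blast
  qed auto
  moreover have "\<Union>?C = UNIV"
  proof -
    have "v \<in> (+) v ` S" for v using assms(1) by (simp only: mem_translate_iff diff_self)
    then show ?thesis by blast
  qed
  ultimately show ?thesis by (metis dvd_triv_left)
qed

section \<open>Divisibility of \<open>p ^ e - 1\<close> by \<open>p ^ i - 1\<close>\<close>

text \<open>
  Euclid's algorithm on the exponents: the difference of \<open>p ^ e - 1\<close> and \<open>p ^ (e - i) - 1\<close> is
  the multiple \<open>p ^ (e - i) * (p ^ i - 1)\<close> of the divisor.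
\<close>

lemma power_minus_1_dvd_iff:
  fixes p :: nat
  assumes "2 \<le> p" "0 < i"
  shows "p ^ i - 1 dvd p ^ e - 1 \<longleftrightarrow> i dvd e"
proof (induction e rule: less_induct)
  case (less e)
  show ?case
  proof (cases "e < i")
    case True
    then have "p ^ e - 1 < p ^ i - 1"
      using assms by (intro diff_less_mono power_strict_increasing) auto
    then have "p ^ i - 1 dvd p ^ e - 1 \<longleftrightarrow> p ^ e - 1 = 0"
      by (metis dvd_0_right nat_dvd_not_less not_gr_zero)
    also have "\<dots> \<longleftrightarrow> e = 0"
      using assms one_less_power[of p e] by (cases e) auto
    also have "\<dots> \<longleftrightarrow> i dvd e"
      using True by (auto dest: dvd_imp_le)
    finally show ?thesis .
  next
    case False
    then have e: "e = (e - i) + i" by simp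
    have ge: "1 \<le> p ^ i" "1 \<le> p ^ (e - i)" using assms by auto
    have "p ^ e - 1 = p ^ (e - i) * (p ^ i - 1) + (p ^ (e - i) - 1)"
      by (subst e, subst power_add) (use ge in \<open>simp add: diff_mult_distrib2\<close>)
    then have "p ^ i - 1 dvd p ^ e - 1 \<longleftrightarrow> p ^ i - 1 dvd p ^ (e - i) - 1"
      by (simp add: dvd_add_right_iff)
    also have "\<dots> \<longleftrightarrow> i dvd e - i" using False assms by (intro less) auto
    also have "\<dots> \<longleftrightarrow> i dvd e" using False by (simp add: dvd_minus_self)
    finally show ?thesis .
  qed
qed

lemma power_minus_1_quotient:
  fixes p :: nat
  assumes "2 \<le> p" "0 < i" "i dvd e"
  shows "(p ^ e - 1) div (p ^ i - 1) * (p ^ i - 1) = p ^ e - 1"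
  using assms by (intro dvd_div_mult_self) (simp only: power_minus_1_dvd_iff)

section \<open>The subfield spanned by the monomial values\<close>

text \<open>
  The additive monoid generated by the monomial values, built up one value at a time. This
  matches walks in the digraph, along which every arc contributes one value.
\<close>

inductive_set monomial_span :: "nat \<Rightarrow> nat \<Rightarrow> 'a::{field,finite} set" for m n where
  zero: "0 \<in> monomial_span m n"
| add: "w \<in> monomial_span m n \<Longrightarrow> w + x ^ m * y ^ n \<in> monomial_span m n"

lemma monomial_in_monomial_span: "x ^ m * y ^ n \<in> monomial_span m n"
  using monomial_span.add[OF monomial_span.zero, of x m y n] by simp

text \<open>
  The monomial values are closed under multiplication, so their sums are too.
\<close>

lemma is_subfield_monomial_span:
  "is_subfield (monomial_span m n :: 'a::{field,finite} set)"
proof (rule is_subfield_finite_semiring)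
  let ?G = "monomial_span m n :: 'a set"
  show "0 \<in> ?G" by (rule monomial_span.zero)
  show "1 \<in> ?G" using monomial_in_monomial_span[of 1 m 1 n] by simp
  show plus: "u + w \<in> ?G" if "u \<in> ?G" "w \<in> ?G" for u w
    using that(2,1) by induction (auto simp: add.assoc[symmetric] intro: monomial_span.add)
  have monomial: "x ^ m * y ^ n * w \<in> ?G" if "w \<in> ?G" for x y w
    using that
  proof induction
    case (add w s t)
    have "x ^ m * y ^ n * (w + s ^ m * t ^ n)
        = x ^ m * y ^ n * w + (x * s) ^ m * (y * t) ^ n"
      by (simp add: algebra_simps power_mult_distrib)
    with add show ?case by (simp add: monomial_span.add)
  qed (simp add: monomial_span.zero)
  show "u * w \<in> ?G" if "u \<in> ?G" "w \<in> ?G" for u w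
    using that(1)
  proof induction
    case (add u x y)
    have "(u + x ^ m * y ^ n) * w = u * w + x ^ m * y ^ n * w" by (rule distrib_right)
    with add.IH \<open>w \<in> ?G\<close> show ?case by (simp only:) (intro plus monomial)
  qed (simp add: monomial_span.zero)
qed

text \<open>
  Adding \<open>1\<close> permutes the field, so the sum of all elements absorbs \<open>CARD('a)\<close> copies of \<open>1\<close>. The
  characteristic therefore divides the prime power \<open>CARD('a)\<close>.
\<close>

lemma CHAR_eq_of_CARD_prime_power:
  assumes "prime p" "CARD('a::{field,finite}) = p ^ e"
  shows "CHAR('a) = p"
proof -
  have pr: "prime CHAR('a)"
    by (rule prime_CHAR_semidom) (rule finite_imp_CHAR_pos, simp)
  have "(\<Sum>x::'a\<in>UNIV. x + 1) = (\<Sum>x::'a\<in>UNIV. x)"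
    by (rule sum.reindex_bij_witness[of _ "\<lambda>x. x - 1" "\<lambda>x. x + 1"]) auto
  then have "of_nat CARD('a) = (0::'a)" by (simp add: sum.distrib)
  then have "CHAR('a) dvd CARD('a)" by (simp add: of_nat_eq_0_iff_char_dvd)
  then have "CHAR('a) dvd p" unfolding assms(2) using pr by (rule prime_dvd_power[rotated])
  with pr assms(1) show ?thesis by (rule primes_dvd_imp_eq)
qed

text \<open>
  The order of the span. That the quotient of \<open>i\<close> is admissible comes from the span containing all
  \<open>m\<close>-th and \<open>n\<close>-th powers; that \<open>i\<close> is least comes from the span being fixed by the \<open>j\<close>-th power of
  the Frobenius map for every admissible \<open>j\<close>.
\<close>

lemma card_monomial_span:
  fixes p e m n :: nat
  defines "G \<equiv> (monomial_span m n :: 'a::{field,finite} set)"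
  defines "quot \<equiv> \<lambda>i. (p ^ e - 1) div (p ^ i - 1)"
  assumes p: "prime p" and q: "CARD('a) = p ^ e" and mn: "0 < m" "0 < n"
  obtains i where "card G = p ^ i" "0 < i" "i dvd e" "quot i dvd gcd (p ^ e - 1) (gcd m n)"
    and "\<And>j. 0 < j \<Longrightarrow> j dvd e \<Longrightarrow> quot j dvd gcd (p ^ e - 1) (gcd m n) \<Longrightarrow> i \<le> j"
proof -
  have G: "is_subfield G" unfolding G_def by (rule is_subfield_monomial_span)
  have p2: "2 \<le> p" using p by (rule prime_ge_2_nat)
  have UNIV_subfield: "is_subfield (UNIV :: 'a set)" by (simp add: is_subfield_def)
  have fermat: "x ^ (p ^ e - 1) = 1" if "x \<noteq> 0" for x :: 'a
    using subfield_power_card_minus_1[OF UNIV_subfield, of x] that q by simp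
  have "card G dvd p ^ e"
    unfolding q[symmetric]
    by (rule additive_subgroup_card_dvd)
      (use G in \<open>auto simp: is_subfield_def, metis diff_conv_add_uminus\<close>)
  then obtain i where i: "card G = p ^ i"
    using p by (metis divides_primepow_nat)
  have i0: "0 < i" using subfield_card_ge_2[OF G] i by (cases i) auto
  have "card G - 1 dvd p ^ e - 1" by (rule subfield_exponent_dvd[OF G]) (rule fermat)
  then have ie: "i dvd e" unfolding i power_minus_1_dvd_iff[OF p2 i0] .
  have exponent: "quot i dvd k" if k: "\<And>x::'a. x ^ k \<in> G" for k
  proof -
    have "p ^ e - 1 dvd k * (p ^ i - 1)"
      using subfield_exponent_dvd[OF UNIV_subfield, of "k * (p ^ i - 1)"]
        subfield_power_card_minus_1[OF G k] q i
      by (simp add: power_mult)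
    then have "quot i * (p ^ i - 1) dvd k * (p ^ i - 1)"
      unfolding quot_def power_minus_1_quotient[OF p2 i0 ie] .
    moreover have "p ^ i - 1 \<noteq> 0" using subfield_card_ge_2[OF G] i by simp
    ultimately show ?thesis using dvd_times_right_cancel_iff by blast
  qed
  have "quot i dvd m"
    by (rule exponent) (use monomial_in_monomial_span[of _ m 1 n] in \<open>simp add: G_def\<close>)
  moreover have "quot i dvd n"
    by (rule exponent) (use monomial_in_monomial_span[of 1 m _ n] in \<open>simp add: G_def\<close>)
  moreover have "quot i dvd p ^ e - 1"
    using power_minus_1_quotient[OF p2 i0 ie] unfolding quot_def by (metis dvd_triv_left)
  ultimately have dvd: "quot i dvd gcd (p ^ e - 1) (gcd m n)" by simp
  have "i \<le> j" if j: "0 < j" "j dvd e" and d: "quot j dvd gcd (p ^ e - 1) (gcd m n)" for j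
  proof -
    have frob: "(x ^ k) ^ (p ^ j) = x ^ k" if k: "quot j dvd k" "0 < k" for x :: 'a and k
    proof (cases "x = 0")
      case False
      have "p ^ e - 1 dvd k * (p ^ j - 1)"
        using mult_dvd_mono[OF k(1) dvd_refl, of "p ^ j - 1"]
        unfolding quot_def power_minus_1_quotient[OF p2 j] .
      then obtain c where "k * (p ^ j - 1) = (p ^ e - 1) * c" by blast
      then have "x ^ (k * (p ^ j - 1)) = 1" using fermat[OF False] by (simp add: power_mult)
      moreover have "p ^ j = Suc (p ^ j - 1)" using p2 by simp
      ultimately show ?thesis by (metis power_Suc power_mult mult.right_neutral)
    qed (use k p2 in \<open>simp add: power_0_left\<close>)
    have char: "CHAR('a) = p" using p q by (rule CHAR_eq_of_CARD_prime_power)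
    have "G \<subseteq> {x. x ^ (p ^ j) = x}"
    proof clarify
      fix w assume "w \<in> G"
      then show "w ^ (p ^ j) = w"
        unfolding G_def
      proof induction
        case (add w x y)
        have "(w + x ^ m * y ^ n) ^ (p ^ j) = w ^ (p ^ j) + (x ^ m * y ^ n) ^ (p ^ j)"
          by (rule freshmans_dream') (use p char in auto)
        also have "(x ^ m * y ^ n) ^ (p ^ j) = x ^ m * y ^ n"
          using d mn by (simp add: power_mult_distrib frob)
        finally show ?case using add by simp
      qed (use p2 in \<open>simp add: power_0_left\<close>)
    qed
    then have "card G \<le> card {x::'a. x ^ (p ^ j) = x}" by (intro card_mono) auto
    also have "\<dots> \<le> p ^ j"
    proof (rule card_power_fixed_points_le)
      show "2 \<le> p ^ j" using power_increasing[of 1 j p] p2 j by simp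
    qed
    finally show "i \<le> j" using i p2 by (simp add: power_increasing_iff)
  qed
  with i i0 ie dvd show thesis using that by blast
qed

section \<open>Signed cosets\<close>

text \<open>
  The set \<open>(v + G) \<union> (-v + G)\<close>: the second coordinates met by the strong component of any \<open>(u, v)\<close>.
\<close>

definition pm_coset :: "'a::ab_group_add set \<Rightarrow> 'a \<Rightarrow> 'a set" where
  "pm_coset G v = {b. b - v \<in> G \<or> b + v \<in> G}"

lemma pm_coset_eq_image:
  "pm_coset G v = (+) v ` G \<union> (+) (- v) ` G"
  by (rule set_eqI)
    (simp only: pm_coset_def Un_iff mem_translate_iff mem_Collect_eq diff_minus_eq_add)

lemma pm_coset_self:
  assumes "is_subfield G"
  shows "v \<in> pm_coset G v"
  using assms by (simp add: pm_coset_def is_subfield_def)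

lemma pm_coset_zero: "pm_coset G 0 = G"
  by (simp add: pm_coset_def)

lemma pm_coset_sym:
  assumes G: "is_subfield G" and b: "b \<in> pm_coset G a"
  shows "a \<in> pm_coset G b"
proof -
  have "0 \<in> G" using G by (simp add: is_subfield_def)
  then have "b - a \<in> G \<Longrightarrow> a - b \<in> G" using subfield_diff[OF G, of 0 "b - a"] by simp
  with b show ?thesis by (auto simp: pm_coset_def add.commute)
qed

lemma pm_coset_trans:
  assumes G: "is_subfield G" and b: "b \<in> pm_coset G a" and c: "c \<in> pm_coset G b"
  shows "c \<in> pm_coset G a"
proof -
  have add: "x + y \<in> G" if "x \<in> G" "y \<in> G" for x y
    using G that by (simp add: is_subfield_def)
  have "c - a = (c - b) + (b - a)" "c + a = (c - b) + (b + a)"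
    "c + a = (c + b) - (b - a)" "c - a = (c + b) - (b + a)"
    by (simp_all add: algebra_simps)
  with b c show ?thesis
    unfolding pm_coset_def mem_Collect_eq by (metis add subfield_diff[OF G])
qed

lemma pm_coset_eqI:
  assumes "is_subfield G" "b \<in> pm_coset G a"
  shows "pm_coset G b = pm_coset G a"
  using assms by (blast intro: pm_coset_trans pm_coset_sym)

lemma pm_coset_exclusive:
  assumes G: "is_subfield G" and v: "v + v \<notin> G" and b: "b - v \<in> G"
  shows "b + v \<notin> G"
proof
  assume "b + v \<in> G"
  from subfield_diff[OF G this b] v show False by (simp add: algebra_simps)
qed

lemma card_pm_coset:
  fixes G :: "'a::{field,finite} set"
  assumes G: "is_subfield G" and v: "v + v \<notin> G"
  shows "card (pm_coset G v) = 2 * card G"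
proof -
  have "(+) v ` G \<inter> (+) (- v) ` G = {}"
    using pm_coset_exclusive[OF G v]
    by (simp only: disjoint_iff mem_translate_iff diff_minus_eq_add) blast
  then show ?thesis
    by (simp add: pm_coset_eq_image card_Un_disjoint card_image)
qed

lemma card_pm_coset_char_2:
  fixes G :: "'a::{field,finite} set"
  assumes "v + v = 0"
  shows "card (pm_coset G v) = card G"
proof -
  have "- v = v" using assms by (rule minus_unique)
  then show ?thesis by (simp only: pm_coset_eq_image Un_absorb) (simp add: card_image)
qed

section \<open>Reachability and strong components\<close>

lemma adj_monomial_digraph:
  "(x, a) \<rightarrow>\<^bsub>monomial_digraph m n\<^esub> (y, b) \<longleftrightarrow> a + b = x ^ m * y ^ n"
  by (auto simp: arcs_ends_def arc_to_ends_def monomial_digraph_def image_def)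

lemma verts_monomial_digraph [simp]: "verts (monomial_digraph m n) = UNIV"
  by (simp add: monomial_digraph_def)

lemma fin_digraph_monomial_digraph: "fin_digraph (monomial_digraph m n)"
  by unfold_locales (auto simp: monomial_digraph_def)

text \<open>
  Since \<open>m\<close> and \<open>n\<close> are positive, the monomial vanishes as soon as one of the two first coordinates
  is \<open>0\<close>, so such arcs just negate the second coordinate. Three of them in a row, by way of
  \<open>(0, - a)\<close> and \<open>(0, a)\<close>, give a walk from \<open>(x, a)\<close> to any \<open>(y, - a)\<close>. Followed by an arc from \<open>(s, - a)\<close> to
  \<open>(t, a + s\<^sup>m t\<^sup>n)\<close>, such walks add any monomial value to the second coordinate.
\<close>

lemma reachable_monomial_digraph_iff:
  fixes x y a b :: "'a::{field,finite}"
  assumes mn: "0 < m" "0 < n"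
  shows "(x, a) \<rightarrow>\<^sup>*\<^bsub>monomial_digraph m n\<^esub> (y, b) \<longleftrightarrow> b \<in> pm_coset (monomial_span m n) a"
proof -
  let ?D = "monomial_digraph m n :: ('a \<times> 'a, ('a \<times> 'a) \<times> ('a \<times> 'a)) pre_digraph"
  let ?G = "monomial_span m n :: 'a set"
  interpret D: fin_digraph ?D by (rule fin_digraph_monomial_digraph)
  have G: "is_subfield ?G" by (rule is_subfield_monomial_span)
  have G_minus: "s - t \<in> ?G" if "s \<in> ?G" "t \<in> ?G" for s t
    using G that by (metis is_subfield_def diff_conv_add_uminus)
  have adj: "(x, a) \<rightarrow>\<^sup>*\<^bsub>?D\<^esub> (y, b)" if "a + b = x ^ m * y ^ n" for x a y b
    using that by (intro D.reachable_adjI) (simp add: adj_monomial_digraph)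
  have neg: "(x, a) \<rightarrow>\<^sup>*\<^bsub>?D\<^esub> (y, - a)" for x a y
  proof -
    have "(x, a) \<rightarrow>\<^sup>*\<^bsub>?D\<^esub> (0, - a)" by (rule adj) (use mn in simp)
    also have "(0, - a) \<rightarrow>\<^sup>*\<^bsub>?D\<^esub> (0, a)" by (rule adj) (use mn in simp)
    also have "(0, a) \<rightarrow>\<^sup>*\<^bsub>?D\<^esub> (y, - a)" by (rule adj) (use mn in simp)
    finally show ?thesis .
  qed
  have same: "(x, a) \<rightarrow>\<^sup>*\<^bsub>?D\<^esub> (y, a)" for x a y
    using D.reachable_trans[OF neg[of x a 0] neg[of 0 "- a" y]] by simp
  have shift: "(x, a) \<rightarrow>\<^sup>*\<^bsub>?D\<^esub> (y, a + w)" if "w \<in> ?G" for x a y w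
    using that
  proof (induction arbitrary: y)
    case zero
    show ?case by (simp add: same)
  next
    case (add w s t)
    have "(x, a) \<rightarrow>\<^sup>*\<^bsub>?D\<^esub> (0, a + w)" by (rule add.IH)
    also have "(0, a + w) \<rightarrow>\<^sup>*\<^bsub>?D\<^esub> (s, - (a + w))" by (rule neg)
    also have "(s, - (a + w)) \<rightarrow>\<^sup>*\<^bsub>?D\<^esub> (t, a + (w + s ^ m * t ^ n))"
      by (rule adj) simp
    also have "(t, a + (w + s ^ m * t ^ n)) \<rightarrow>\<^sup>*\<^bsub>?D\<^esub> (y, a + (w + s ^ m * t ^ n))"
      by (rule same)
    finally show ?case .
  qed
  show ?thesis
  proof
    assume "(x, a) \<rightarrow>\<^sup>*\<^bsub>?D\<^esub> (y, b)"
    then have "snd (y, b) \<in> pm_coset ?G (snd (x, a))"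
    proof (induction rule: D.reachable_induct)
      case base
      show ?case using G by (simp add: pm_coset_def is_subfield_def)
    next
      case (step u v)
      obtain s c t c' where uv: "u = (s, c)" "v = (t, c')" by fastforce
      from step(2) have c': "c' = s ^ m * t ^ n - c"
        by (simp add: uv adj_monomial_digraph algebra_simps)
      have "c' + a = s ^ m * t ^ n - (c - a)" "c' - a = s ^ m * t ^ n - (c + a)"
        by (simp_all add: c' algebra_simps)
      then have "c - a \<in> ?G \<Longrightarrow> c' + a \<in> ?G" "c + a \<in> ?G \<Longrightarrow> c' - a \<in> ?G"
        by (simp_all only: G_minus[OF monomial_in_monomial_span])
      with step(3) show ?case by (auto simp: uv pm_coset_def)
    qed
    then show "b \<in> pm_coset ?G a" by simp
  next
    assume "b \<in> pm_coset ?G a"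
    then consider "b - a \<in> ?G" | "b + a \<in> ?G" by (auto simp: pm_coset_def)
    then show "(x, a) \<rightarrow>\<^sup>*\<^bsub>?D\<^esub> (y, b)"
    proof cases
      case 1
      from shift[OF this, of x a y] show ?thesis by simp
    next
      case 2
      from D.reachable_trans[OF neg[of x a 0] shift[OF this, of 0 "- a" y]] show ?thesis
        by simp
    qed
  qed
qed

lemma sccs_monomial_digraph:
  fixes m n :: nat
  defines "D \<equiv> (monomial_digraph m n
      :: ('a::{field,finite} \<times> 'a, ('a \<times> 'a) \<times> ('a \<times> 'a)) pre_digraph)"
  assumes mn: "0 < m" "0 < n"
  shows "pre_digraph.sccs D = range (\<lambda>v. D \<restriction> (UNIV \<times> pm_coset (monomial_span m n) v))"
proof -
  interpret D: fin_digraph D unfolding D_def by (rule fin_digraph_monomial_digraph)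
  let ?G = "monomial_span m n :: 'a set"
  have G: "is_subfield ?G" by (rule is_subfield_monomial_span)
  have "D.scc_of (x, a) = UNIV \<times> pm_coset ?G a" for x a
    using pm_coset_sym[OF G]
    unfolding D.scc_of_def unfolding D_def
    by (auto simp: reachable_monomial_digraph_iff[OF mn])
  then have "D.sccs_verts = range (\<lambda>v. UNIV \<times> pm_coset ?G v)"
    unfolding D.sccs_verts_conv_scc_of by (auto simp: D_def image_def)
  then show ?thesis by (simp add: D.sccs_conv_sccs_verts image_image)
qed

lemma monomial_scc_eq:
  fixes m n :: nat
  defines "D \<equiv> (monomial_digraph m n
      :: ('a::{field,finite} \<times> 'a, ('a \<times> 'a) \<times> ('a \<times> 'a)) pre_digraph)"
  assumes mn: "0 < m" "0 < n" and C: "C \<in> pre_digraph.sccs D" "(u, v) \<in> verts C"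
  shows "C = D \<restriction> (UNIV \<times> pm_coset (monomial_span m n) v)"
proof -
  obtain w where w: "C = D \<restriction> (UNIV \<times> pm_coset (monomial_span m n) w)"
    using C(1) unfolding D_def sccs_monomial_digraph[OF mn] by blast
  then have "v \<in> pm_coset (monomial_span m n) w" using C(2) by simp
  then show ?thesis using w pm_coset_eqI[OF is_subfield_monomial_span] by metis
qed

text \<open>
  Strong components have disjoint vertex sets and are determined by them.
\<close>

lemma (in wf_digraph) card_sccs_equal_order:
  assumes X: "X \<subseteq> sccs" and fin: "finite (verts G)" and k: "\<And>C. C \<in> X \<Longrightarrow> card (verts C) = k"
  shows "k * card X = card (\<Union>C\<in>X. verts C)"
proof -
  have sub: "verts ` X \<subseteq> sccs_verts" using X by (auto simp: sccs_verts_conv)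
  then have sub_Pow: "verts ` X \<subseteq> Pow (verts G)" using sccs_verts_subsets by blast
  have "k * card (verts ` X) = card (\<Union>(verts ` X))"
  proof (rule card_partition)
    show "finite (verts ` X)" using sub_Pow fin by (meson finite_Pow_iff finite_subset)
    show "finite (\<Union>(verts ` X))" using sub_Pow fin by (meson Sup_le_iff Pow_iff finite_subset subset_iff)
    show "S \<inter> T = {}" if "S \<in> verts ` X" "T \<in> verts ` X" "S \<noteq> T" for S T
      using that sub by (intro sccs_verts_disjoint) auto
  qed (use k in auto)
  moreover have "card (verts ` X) = card X"
    by (rule card_image) (rule inj_on_subset[OF inj_on_verts_sccs X])
  ultimately show ?thesis by simp
qed

section \<open>Isomorphisms between strong components\<close>

text \<open>
  The monomial depends on the first coordinates alone, so a map that moves only second coordinates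
  respects arcs in both directions once it keeps the sum of the two second coordinates whenever
  that sum, before or after the map, can be a monomial value.
\<close>

lemma digraph_iso_induced_by_second_coordinate:
  fixes m n :: nat
  defines "D \<equiv> (monomial_digraph m n
      :: ('a::{field,finite} \<times> 'a, ('a \<times> 'a) \<times> ('a \<times> 'a)) pre_digraph)"
  assumes h: "bij_betw h S T"
    and sum: "\<And>a b. a \<in> S \<Longrightarrow> b \<in> S \<Longrightarrow>
      a + b \<in> monomial_span m n \<or> h a + h b \<in> monomial_span m n \<Longrightarrow> h a + h b = a + b"
  shows "digraph_iso (D \<restriction> (UNIV \<times> S)) (D \<restriction> (UNIV \<times> T))"
proof -
  interpret D: fin_digraph D unfolding D_def by (rule fin_digraph_monomial_digraph)
  have arcs: "arcs (D \<restriction> (UNIV \<times> S))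
      = {((x, a), (y, b)) | x a y b. a \<in> S \<and> b \<in> S \<and> a + b = x ^ m * y ^ n}" for S
    by (auto simp: D_def monomial_digraph_def induce_subgraph_def)
  define hv where "hv = (\<lambda>(x::'a, a). (x, h a))"
  define f where "f = \<lparr>iso_verts = hv, iso_arcs = (\<lambda>(u, v). (hv u, hv v)),
    iso_head = snd, iso_tail = fst\<rparr>"
  have inj: "inj_on h S" and T: "T = h ` S" using h by (auto simp: bij_betw_def)
  have "pre_digraph.digraph_isomorphism (D \<restriction> (UNIV \<times> S)) f"
    unfolding pre_digraph.digraph_isomorphism_def
  proof (intro conjI)
    show "wf_digraph (D \<restriction> (UNIV \<times> S))" by (rule D.wellformed_induce_subgraph)
    show "inj_on (iso_verts f) (verts (D \<restriction> (UNIV \<times> S)))"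
      using inj by (auto simp: f_def hv_def inj_on_def)
    show "inj_on (iso_arcs f) (arcs (D \<restriction> (UNIV \<times> S)))"
      unfolding arcs using inj by (auto simp: f_def hv_def inj_on_def)
    show "\<forall>a\<in>arcs (D \<restriction> (UNIV \<times> S)).
        iso_verts f (tail (D \<restriction> (UNIV \<times> S)) a) = iso_tail f (iso_arcs f a) \<and>
        iso_verts f (head (D \<restriction> (UNIV \<times> S)) a) = iso_head f (iso_arcs f a)"
      by (auto simp: f_def D_def monomial_digraph_def)
  qed
  moreover have "D \<restriction> (UNIV \<times> T) = app_iso f (D \<restriction> (UNIV \<times> S))"
  proof (rule pre_digraph.equality)
    show "verts (D \<restriction> (UNIV \<times> T)) = verts (app_iso f (D \<restriction> (UNIV \<times> S)))"
      by (auto simp: T f_def hv_def image_iff)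
    show "arcs (D \<restriction> (UNIV \<times> T)) = arcs (app_iso f (D \<restriction> (UNIV \<times> S)))"
    proof
      show "arcs (D \<restriction> (UNIV \<times> T)) \<subseteq> arcs (app_iso f (D \<restriction> (UNIV \<times> S)))"
      proof
        fix arc assume "arc \<in> arcs (D \<restriction> (UNIV \<times> T))"
        then obtain x a y b where arc: "arc = ((x, h a), (y, h b))"
          and ab: "a \<in> S" "b \<in> S" and eq: "h a + h b = x ^ m * y ^ n"
          unfolding arcs T by blast
        have "h a + h b = a + b"
          using eq monomial_in_monomial_span[of x m y n] by (intro sum ab) simp
        then have "((x, a), (y, b)) \<in> arcs (D \<restriction> (UNIV \<times> S))"
          unfolding arcs using ab eq by simp
        moreover have "arc = iso_arcs f ((x, a), (y, b))" by (simp add: arc f_def hv_def)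
        ultimately show "arc \<in> arcs (app_iso f (D \<restriction> (UNIV \<times> S)))"
          unfolding arcs_app_iso by blast
      qed
      show "arcs (app_iso f (D \<restriction> (UNIV \<times> S))) \<subseteq> arcs (D \<restriction> (UNIV \<times> T))"
      proof
        fix arc assume "arc \<in> arcs (app_iso f (D \<restriction> (UNIV \<times> S)))"
        then obtain x a y b where arc: "arc = ((x, h a), (y, h b))"
          and ab: "a \<in> S" "b \<in> S" and eq: "a + b = x ^ m * y ^ n"
          unfolding arcs_app_iso arcs by (auto simp: f_def hv_def)
        have "h a + h b = a + b"
          using eq monomial_in_monomial_span[of x m y n] by (intro sum ab) simp
        then show "arc \<in> arcs (D \<restriction> (UNIV \<times> T))"
          unfolding arcs T using ab eq arc by auto
      qed
    qed
  qed (simp_all add: f_def D_def monomial_digraph_def)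
  ultimately show ?thesis unfolding digraph_iso_def by blast
qed

text \<open>
  The isomorphism sends \<open>v + g\<close> to \<open>v' + g\<close> and \<open>- v + g\<close> to \<open>- v' + g\<close>. It is well defined because
  the two cosets are disjoint. Two second coordinates with a sum in \<open>G\<close> lie in opposite cosets,
  since otherwise \<open>v + v\<close> or \<open>v' + v'\<close> would be in \<open>G\<close>; in the sum the shifts by \<open>v' - v\<close> and
  \<open>v - v'\<close> cancel.
\<close>

lemma digraph_iso_pm_cosets:
  fixes m n :: nat and v v' :: "'a::{field,finite}"
  defines "D \<equiv> (monomial_digraph m n :: ('a \<times> 'a, ('a \<times> 'a) \<times> ('a \<times> 'a)) pre_digraph)"
    and "G \<equiv> (monomial_span m n :: 'a set)"
  assumes v: "v + v \<notin> G" and v': "v' + v' \<notin> G"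
  shows "digraph_iso (D \<restriction> (UNIV \<times> pm_coset G v)) (D \<restriction> (UNIV \<times> pm_coset G v'))"
proof -
  have G: "is_subfield G" unfolding G_def by (rule is_subfield_monomial_span)
  define h where "h = (\<lambda>v v' a. if a - v \<in> G then a - v + v' else a + v - v')"
  have pos: "h v v' a - v' = a - v" if "a - v \<in> G" for a v v'
    using that by (simp add: h_def)
  have neg: "h v v' a + v' = a + v" if "v + v \<notin> G" "a + v \<in> G" for a v v'
    using that pm_coset_exclusive[OF G that(1), of a] by (auto simp: h_def)
  have cases: "(a - v \<in> G \<and> h v v' a - v' = a - v) \<or> (a + v \<in> G \<and> h v v' a + v' = a + v)"
    if "v + v \<notin> G" "a \<in> pm_coset G v" for a v v'
    using that pos neg by (auto simp: pm_coset_def)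
  have h_in: "h v v' a \<in> pm_coset G v'" if "v + v \<notin> G" "a \<in> pm_coset G v" for a v v'
    using cases[OF that, of v'] by (auto simp: pm_coset_def)
  have h_h: "h v' v (h v v' a) = a"
    if "v + v \<notin> G" "v' + v' \<notin> G" "a \<in> pm_coset G v" for a v v'
    using cases[OF that(1,3), of v']
  proof
    assume a: "a - v \<in> G \<and> h v v' a - v' = a - v"
    then have "h v' v (h v v' a) - v = h v v' a - v'" by (intro pos) simp
    with a show ?thesis by simp
  next
    assume a: "a + v \<in> G \<and> h v v' a + v' = a + v"
    then have "h v' v (h v v' a) + v = h v v' a + v'" by (intro neg that) simp
    with a show ?thesis by simp
  qed
  show ?thesis
    unfolding D_def
  proof (rule digraph_iso_induced_by_second_coordinate)
    show "bij_betw (h v v') (pm_coset G v) (pm_coset G v')"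
      by (rule bij_betw_byWitness[where f' = "h v' v"]) (use v v' h_h h_in in auto)
  next
    fix a b
    assume a: "a \<in> pm_coset G v" and b: "b \<in> pm_coset G v"
      and "a + b \<in> monomial_span m n \<or> h v v' a + h v v' b \<in> monomial_span m n"
    then have sum: "a + b \<in> G \<or> h v v' a + h v v' b \<in> G" by (simp add: G_def)
    have not_pos: False if "c + d \<in> G" "c - w \<in> G" "d - w \<in> G" "w + w \<notin> G" for c d w
    proof -
      have "w + w = (c + d - (c - w)) - (d - w)" by (simp add: algebra_simps)
      with that show False by (metis subfield_diff[OF G])
    qed
    have not_neg: False if "c + d \<in> G" "c + w \<in> G" "d + w \<in> G" "w + w \<notin> G" for c d w
    proof -
      have "w + w = (c + w) - ((c + d) - (d + w))" by (simp add: algebra_simps)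
      with that show False by (metis subfield_diff[OF G])
    qed
    from cases[OF v a, of v'] cases[OF v b, of v']
    show "h v v' a + h v v' b = a + b"
    proof (elim disjE conjE)
      assume "a - v \<in> G" "h v v' a - v' = a - v" "b - v \<in> G" "h v v' b - v' = b - v"
      then show ?thesis using sum not_pos v v' by metis
    next
      assume "a + v \<in> G" "h v v' a + v' = a + v" "b + v \<in> G" "h v v' b + v' = b + v"
      then show ?thesis using sum not_neg v v' by metis
    next
      assume "h v v' a - v' = a - v" "h v v' b + v' = b + v"
      then have "(h v v' a - v') + (h v v' b + v') = (a - v) + (b + v)" by simp
      then show ?thesis by simp
    next
      assume "h v v' a + v' = a + v" "h v v' b - v' = b - v"
      then have "(h v v' a + v') + (h v v' b - v') = (a + v) + (b - v)" by simp
      then show ?thesis by simp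
    qed
  qed
qed

text \<open>
  A translation works for all pairs of components here, because the shift is
  added twice in a sum of two second coordinates.
\<close>

lemma digraph_iso_pm_cosets_char_2:
  fixes m n :: nat and v v' :: "'a::{field,finite}"
  defines "D \<equiv> (monomial_digraph m n :: ('a \<times> 'a, ('a \<times> 'a) \<times> ('a \<times> 'a)) pre_digraph)"
    and "G \<equiv> (monomial_span m n :: 'a set)"
  assumes char_2: "\<And>x::'a. x + x = 0"
  shows "digraph_iso (D \<restriction> (UNIV \<times> pm_coset G v)) (D \<restriction> (UNIV \<times> pm_coset G v'))"
  unfolding D_def
proof (rule digraph_iso_induced_by_second_coordinate)
  have minus: "- x = x" for x :: 'a using char_2 by (rule minus_unique)
  then have diff: "x - y = x + y" for x y :: 'a by (metis diff_conv_add_uminus)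
  have cancel: "x + (x + y) = y" for x y :: 'a
    by (simp add: char_2 flip: add.assoc)
  show "bij_betw (\<lambda>a. a + (v + v')) (pm_coset G v) (pm_coset G v')"
    by (rule bij_betw_byWitness[where f' = "\<lambda>a. a + (v + v')"])
      (auto simp: pm_coset_def diff char_2 cancel add_ac)
  show "a + (v + v') + (b + (v + v')) = a + b" for a b
    by (simp add: char_2 cancel add_ac)
qed

section \<open>Orders and number of the strong components\<close>

theorem theorem2:
  fixes p e q m n d es qs :: nat
    and quot :: "nat \<Rightarrow> nat"
    and F :: "'a::{field,finite} set"
    and D :: "('a \<times> 'a, ('a \<times> 'a) \<times> ('a \<times> 'a)) pre_digraph"
  assumes "prime p" and "e > 0" and "q = p ^ e" and "CARD('a) = q"
    and "1 \<le> m" and "m \<le> q - 1" and "1 \<le> n" and "n \<le> q - 1"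
    and "D = monomial_digraph m n"
    and "d = gcd (q - 1) (gcd m n)"
    and "\<And>i. quot i = (q - 1) div (p ^ i - 1)"
    and "es > 0" and "es dvd e" and "qs = quot es"
    and "qs = Max {quot i | i. i > 0 \<and> i dvd e \<and> quot i dvd d}"
    and "F = subfield_of_card (p ^ es)"
  shows
    "(\<forall>u v. (\<exists>!C. C \<in> pre_digraph.sccs D \<and> (u, v) \<in> verts C) \<and>
        (\<forall>C \<in> pre_digraph.sccs D. (u, v) \<in> verts C \<longrightarrow>
           verts C = {(x, v + w) | x w. w \<in> F} \<union> {(x, - v + w) | x w. w \<in> F})) \<and>
     (strongly_connected D \<longleftrightarrow> qs = 1) \<and> (qs = 1 \<longleftrightarrow> es = e) \<and>
     (odd q \<longrightarrow>
        card (pre_digraph.sccs D) = (p ^ (e - es) + 1) div 2 \<and>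
        (\<exists>C0 \<in> pre_digraph.sccs D.
           card (verts C0) = p ^ (e + es) \<and>
           card (pre_digraph.sccs D - {C0}) = (p ^ (e - es) - 1) div 2 \<and>
           (\<forall>C \<in> pre_digraph.sccs D - {C0}. card (verts C) = 2 * p ^ (e + es)) \<and>
           (\<forall>C \<in> pre_digraph.sccs D - {C0}. \<forall>C' \<in> pre_digraph.sccs D - {C0}. digraph_iso C C'))) \<and>
     (even q \<longrightarrow>
        card (pre_digraph.sccs D) = 2 ^ (e - es) \<and>
        (\<forall>C \<in> pre_digraph.sccs D. card (verts C) = 2 ^ (e + es)) \<and>
        (\<forall>C \<in> pre_digraph.sccs D. \<forall>C' \<in> pre_digraph.sccs D. digraph_iso C C'))"
proof -
  define G :: "'a set" where "G = monomial_span m n"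
  have p2: "2 \<le> p" using \<open>prime p\<close> by (rule prime_ge_2_nat)
  have mn: "0 < m" "0 < n" using \<open>1 \<le> m\<close> \<open>1 \<le> n\<close> by simp_all
  have q: "CARD('a) = p ^ e" using assms by simp
  have G: "is_subfield G" unfolding G_def by (rule is_subfield_monomial_span)
  have quot: "quot i = (p ^ e - 1) div (p ^ i - 1)" for i using assms by simp
  have quot_mult: "quot i * (p ^ i - 1) = p ^ e - 1" if "0 < i" "i dvd e" for i
    unfolding quot by (rule power_minus_1_quotient[OF p2 that])
  have d: "d = gcd (p ^ e - 1) (gcd m n)" using assms by simp
  have pe: "0 < p ^ e - 1" using one_less_power[of p e] p2 \<open>e > 0\<close> by simp
  have es_le: "es \<le> e" using \<open>es dvd e\<close> \<open>e > 0\<close> by (rule dvd_imp_le)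
  obtain i where i: "card G = p ^ i" "0 < i" "i dvd e" "quot i dvd d"
    and i_least: "\<And>j. 0 < j \<Longrightarrow> j dvd e \<Longrightarrow> quot j dvd d \<Longrightarrow> i \<le> j"
    using card_monomial_span[OF \<open>prime p\<close> q mn] unfolding G_def quot d by metis
  \<comment> \<open>On the positive divisors of \<open>e\<close>, \<open>quot\<close> is strictly decreasing, so the maximal admissible
    quotient belongs to the least admissible exponent.\<close>
  have "i = es"
  proof (rule le_antisym)
    let ?Q = "{quot i | i. i > 0 \<and> i dvd e \<and> quot i dvd d}"
    have "?Q \<subseteq> quot ` {..e}" using \<open>e > 0\<close> by (auto dest: dvd_imp_le)
    then have fin: "finite ?Q" by (rule finite_subset) simp
    have i_Q: "quot i \<in> ?Q" using i by blast
    have "qs \<in> ?Q" unfolding \<open>qs = Max ?Q\<close> using fin i_Q by (intro Max_in) auto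
    then have "quot es dvd d" using \<open>qs = quot es\<close> by auto
    then show "i \<le> es" by (intro i_least assms)
    have "quot i \<le> quot es"
      using Max_ge[OF fin i_Q] \<open>qs = Max ?Q\<close> \<open>qs = quot es\<close> by simp
    show "es \<le> i"
    proof (rule ccontr)
      assume "\<not> es \<le> i"
      then have "p ^ i < p ^ es" using p2 by (intro power_strict_increasing) auto
      moreover have "1 \<le> p ^ i" using p2 by simp
      ultimately have "p ^ i - 1 < p ^ es - 1" by (rule diff_less_mono)
      moreover have "0 < quot i" using quot_mult[OF i(2,3)] pe by (metis mult_0 neq0_conv)
      ultimately have "quot i * (p ^ i - 1) < quot es * (p ^ es - 1)"
        using \<open>quot i \<le> quot es\<close> by (intro mult_le_less_imp_less) auto
      then show False by (simp only: quot_mult[OF i(2,3)] quot_mult[OF \<open>es > 0\<close> \<open>es dvd e\<close>])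
    qed
  qed
  with i have card_G: "card G = p ^ es" by simp
  then have F: "F = G" using subfield_of_card_eqI[OF G] \<open>F = subfield_of_card (p ^ es)\<close> by simp
  have D: "D = monomial_digraph m n" by fact
  define K where "K v = D \<restriction> (UNIV \<times> pm_coset G v)" for v
  have verts_K: "verts (K v) = UNIV \<times> pm_coset G v" for v by (simp add: K_def)
  have sccs: "pre_digraph.sccs D = range K"
    unfolding D K_def G_def by (rule sccs_monomial_digraph[OF mn])
  have scc_eq: "C = K v" if "C \<in> pre_digraph.sccs D" "(u, v) \<in> verts C" for C u v
    using that unfolding D K_def G_def by (rule monomial_scc_eq[OF mn])
  have K_scc: "K v \<in> pre_digraph.sccs D" for v unfolding sccs by (rule rangeI)
  have mem_K: "(u, v) \<in> verts (K v)" for u v using pm_coset_self[OF G] by (simp add: verts_K)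
  interpret D: fin_digraph D unfolding D by (rule fin_digraph_monomial_digraph)

  have part_i: "(\<exists>!C. C \<in> pre_digraph.sccs D \<and> (u, v) \<in> verts C) \<and>
        (\<forall>C \<in> pre_digraph.sccs D. (u, v) \<in> verts C \<longrightarrow>
           verts C = {(x, v + w) | x w. w \<in> F} \<union> {(x, - v + w) | x w. w \<in> F})" for u v
  proof (intro conjI ballI impI)
    show "\<exists>!C. C \<in> pre_digraph.sccs D \<and> (u, v) \<in> verts C"
      by (rule ex1I[of _ "K v"]) (use K_scc mem_K in \<open>auto dest: scc_eq\<close>)
    fix C assume "C \<in> pre_digraph.sccs D" "(u, v) \<in> verts C"
    then have "verts C = UNIV \<times> pm_coset G v" by (auto dest: scc_eq simp: verts_K)
    then show "verts C = {(x, v + w) | x w. w \<in> F} \<union> {(x, - v + w) | x w. w \<in> F}"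
      unfolding pm_coset_eq_image F by blast
  qed

  have qs_iff: "qs = 1 \<longleftrightarrow> es = e"
  proof
    assume "qs = 1"
    then have "p ^ es - 1 = p ^ e - 1"
      using quot_mult[OF \<open>es > 0\<close> \<open>es dvd e\<close>] \<open>qs = quot es\<close> by simp
    moreover have "1 \<le> p ^ es" "1 \<le> p ^ e" using p2 by simp_all
    ultimately have "p ^ es = p ^ e" by linarith
    then show "es = e" using p2 by (simp add: power_inject_exp)
  next
    assume "es = e"
    then show "qs = 1" unfolding \<open>qs = quot es\<close> quot using pe by simp
  qed
  have strong_iff: "strongly_connected D \<longleftrightarrow> qs = 1"
  proof -
    have "strongly_connected D \<longleftrightarrow> (\<forall>a b. b \<in> pm_coset G a)"
      unfolding strongly_connected_def
      by (auto simp: D G_def reachable_monomial_digraph_iff[OF mn])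
    also have "\<dots> \<longleftrightarrow> G = UNIV"
    proof
      assume "\<forall>a b. b \<in> pm_coset G a"
      then have "\<forall>b. b \<in> pm_coset G 0" by blast
      then show "G = UNIV" unfolding pm_coset_zero by blast
    qed (simp add: pm_coset_def)
    also have "\<dots> \<longleftrightarrow> card G = CARD('a)"
      by (metis card_subset_eq finite subset_UNIV)
    also have "\<dots> \<longleftrightarrow> qs = 1" unfolding card_G q qs_iff using p2 by (simp add: power_inject_exp)
    finally show ?thesis .
  qed

  have card_D: "card (UNIV :: ('a \<times> 'a) set) = p ^ (e + es) * p ^ (e - es)"
  proof -
    have "card (UNIV :: ('a \<times> 'a) set) = p ^ (e + e)" by (simp add: q power_add)
    also have "e + e = (e + es) + (e - es)" using es_le by simp
    finally show ?thesis by (simp only: power_add)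
  qed
  have card_K: "card (verts (K v)) = p ^ e * card (pm_coset G v)" for v
    using q by (simp add: verts_K card_cartesian_product)
  have order_pos: "0 < p ^ (e + es)" using p2 by simp

  have part_odd: "card (pre_digraph.sccs D) = (p ^ (e - es) + 1) div 2 \<and>
        (\<exists>C0 \<in> pre_digraph.sccs D.
           card (verts C0) = p ^ (e + es) \<and>
           card (pre_digraph.sccs D - {C0}) = (p ^ (e - es) - 1) div 2 \<and>
           (\<forall>C \<in> pre_digraph.sccs D - {C0}. card (verts C) = 2 * p ^ (e + es)) \<and>
           (\<forall>C \<in> pre_digraph.sccs D - {C0}. \<forall>C' \<in> pre_digraph.sccs D - {C0}. digraph_iso C C'))"
    if "odd q"
  proof -
    have double: "v \<in> G" if "v + v \<in> G" for v
    proof -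
      have "CHAR('a) = p" using \<open>prime p\<close> q by (rule CHAR_eq_of_CARD_prime_power)
      moreover have "\<not> p dvd 2"
        using \<open>odd q\<close> \<open>q = p ^ e\<close> \<open>e > 0\<close> \<open>prime p\<close> by (metis dvd_power primes_dvd_imp_eq two_is_prime_nat)
      ultimately have "of_nat 2 \<noteq> (0::'a)" by (simp only: of_nat_eq_0_iff_char_dvd not_False_eq_True)
      then have two: "(2::'a) \<noteq> 0" by simp
      have "1 + 1 \<in> G" using G by (simp only: is_subfield_def)
      then have "inverse (1 + 1) \<in> G" using G unfolding is_subfield_def by blast
      then have "inverse (1 + 1) * (v + v) \<in> G" using G that unfolding is_subfield_def by blast
      also have "inverse (1 + 1) * (v + v) = v" using two by (simp add: mult_2[symmetric])
      finally show ?thesis .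
    qed
    have other: "\<exists>v. C = K v \<and> v + v \<notin> G" if "C \<in> pre_digraph.sccs D - {K 0}" for C
    proof -
      from that obtain v where v: "C = K v" "K v \<noteq> K 0" unfolding sccs by blast
      have "v \<notin> G"
      proof
        assume "v \<in> G"
        then have "pm_coset G v = pm_coset G 0"
          using pm_coset_eqI[OF G, of v 0] by (simp add: pm_coset_zero)
        with v show False by (simp add: K_def)
      qed
      with double v show ?thesis by blast
    qed
    have card_K0: "card (verts (K 0)) = p ^ (e + es)"
      by (simp add: card_K pm_coset_zero card_G power_add)
    have card_other: "card (verts C) = 2 * p ^ (e + es)" if "C \<in> pre_digraph.sccs D - {K 0}" for C
      using other[OF that] by (auto simp: card_K card_pm_coset[OF G] card_G power_add)
    have iso: "digraph_iso C C'"
      if "C \<in> pre_digraph.sccs D - {K 0}" "C' \<in> pre_digraph.sccs D - {K 0}" for C C'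
      using other[OF that(1)] other[OF that(2)] digraph_iso_pm_cosets[of _ m n]
      unfolding K_def D G_def by blast
    have fin: "finite (pre_digraph.sccs D)" unfolding sccs by simp
    \<comment> \<open>The components other than \<open>K 0\<close> have equal order and fill the rest of the plane.\<close>
    let ?N = "card (pre_digraph.sccs D - {K 0})"
    have "(\<Union>C \<in> pre_digraph.sccs D - {K 0}. verts C) = UNIV - verts (K 0)"
    proof (rule set_eqI, clarify)
      fix u v
      have "(u, v) \<in> verts C \<longleftrightarrow> C = K v" if "C \<in> pre_digraph.sccs D" for C
        using scc_eq[OF that] mem_K by metis
      then have "(u, v) \<in> (\<Union>C \<in> pre_digraph.sccs D - {K 0}. verts C) \<longleftrightarrow> K v \<noteq> K 0"
        using K_scc by auto
      also have "\<dots> \<longleftrightarrow> (u, v) \<in> UNIV - verts (K 0)"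
        using scc_eq[OF K_scc[of 0]] mem_K by (metis DiffI DiffD2 UNIV_I)
      finally show "(u, v) \<in> (\<Union>C \<in> pre_digraph.sccs D - {K 0}. verts C)
          \<longleftrightarrow> (u, v) \<in> UNIV - verts (K 0)" .
    qed
    then have "2 * p ^ (e + es) * ?N = card (UNIV - verts (K 0))"
      using D.card_sccs_equal_order[of "pre_digraph.sccs D - {K 0}"] card_other
      by simp
    also have "\<dots> = p ^ (e + es) * p ^ (e - es) - p ^ (e + es)"
      by (simp only: card_Diff_subset[OF finite subset_UNIV] card_D card_K0)
    also have "\<dots> = p ^ (e + es) * (p ^ (e - es) - 1)" by (simp add: diff_mult_distrib2)
    finally have "p ^ (e + es) * (2 * ?N) = p ^ (e + es) * (p ^ (e - es) - 1)"
      by (simp only: mult.assoc mult.left_commute)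
    then have "2 * ?N = p ^ (e - es) - 1" using nat_mult_eq_cancel1[OF order_pos] by blast
    moreover have "1 \<le> p ^ (e - es)" using p2 by simp
    ultimately have N: "p ^ (e - es) = 2 * ?N + 1" by linarith
    have "card (pre_digraph.sccs D) = Suc ?N"
      by (rule card_Suc_Diff1[symmetric]) (use fin sccs in auto)
    with N have "card (pre_digraph.sccs D) = (p ^ (e - es) + 1) div 2" by simp
    moreover have "?N = (p ^ (e - es) - 1) div 2" using N by simp
    ultimately show ?thesis
      using card_K0 card_other iso by (intro conjI bexI[OF _ K_scc[of 0]] ballI) simp_all
  qed

  have part_even: "card (pre_digraph.sccs D) = 2 ^ (e - es) \<and>
        (\<forall>C \<in> pre_digraph.sccs D. card (verts C) = 2 ^ (e + es)) \<and>
        (\<forall>C \<in> pre_digraph.sccs D. \<forall>C' \<in> pre_digraph.sccs D. digraph_iso C C')"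
    if "even q"
  proof -
    have p_2: "p = 2"
      using \<open>even q\<close> \<open>q = p ^ e\<close> \<open>prime p\<close>
      by (metis prime_dvd_power primes_dvd_imp_eq two_is_prime_nat)
    have "CHAR('a) = 2"
      using CHAR_eq_of_CARD_prime_power[OF \<open>prime p\<close> q] p_2 by simp
    then have "of_nat 2 = (0::'a)" by (metis of_nat_CHAR)
    then have char_2: "x + x = 0" for x :: 'a by (simp add: mult_2[symmetric])
    have card_scc: "card (verts C) = 2 ^ (e + es)" if "C \<in> pre_digraph.sccs D" for C
      using that unfolding sccs
      by (auto simp: card_K card_pm_coset_char_2[OF char_2] card_G power_add p_2)
    have "(\<Union>C \<in> pre_digraph.sccs D. verts C) = UNIV"
      using mem_K unfolding sccs by auto
    then have "2 ^ (e + es) * card (pre_digraph.sccs D) = card (UNIV :: ('a \<times> 'a) set)"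
      using D.card_sccs_equal_order[of "pre_digraph.sccs D"] card_scc by simp
    also have "\<dots> = 2 ^ (e + es) * 2 ^ (e - es)" unfolding card_D p_2 ..
    finally have "card (pre_digraph.sccs D) = 2 ^ (e - es)" by simp
    moreover have "digraph_iso C C'"
      if "C \<in> pre_digraph.sccs D" "C' \<in> pre_digraph.sccs D" for C C'
    proof -
      from that obtain v v' where "C = K v" "C' = K v'" unfolding sccs by blast
      then show ?thesis
        unfolding K_def D G_def by (simp only:) (rule digraph_iso_pm_cosets_char_2[OF char_2])
    qed
    ultimately show ?thesis using card_scc by blast
  qed

  show ?thesis using part_i strong_iff qs_iff part_odd part_even by blast
qed

end
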